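(* Let $k$ be a field of characteristic zero and let $S=\{z^d+c : d\geq2,\ c\in k^*\}\subset k[z]$, where $d$ ranges over the integers $\ge 2$ and $c$ over the nonzero elements of $k$. Then the semigroup generated by $S$ under composition is free.
   Context: Free means free on the generating set $S$: whenever $\theta_1\circ\cdots\circ\theta_r=\tau_1\circ\cdots\circ\tau_k$ as polynomials, with $r,k\ge1$ and $\theta_i,\tau_j\in S$, one has $r=k$ and $\theta_i=\tau_i$ for all $1\le i\le r$. *)

theory Defs
  imports "HOL-Computational_Algebra.Polynomial"
begin

definition unicritical_polys :: "'a::field_char_0 poly set" where
  "unicritical_polys = {monom 1 d + [:c:] | d c. 2 \<le> d \<and> c \<noteq> 0}"

text \<open>The composition of the word \<open>[p\<^sub>1, \<dots>, p\<^sub>r]\<close> is the polynomial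
  \<open>p\<^sub>1 \<circ> \<dots> \<circ> p\<^sub>r\<close>, with the last factor applied first; the empty word gives the
  identity polynomial \<open>z\<close>.\<close>

definition comp_word :: "'a::comm_semiring_1 poly list \<Rightarrow> 'a poly" where
  "comp_word ps = foldr pcompose ps [:0, 1:]"

text \<open>The semigroup generated by \<open>S\<close> under composition is the set of all \<open>comp_word ps\<close>
  for nonempty words \<open>ps\<close> over \<open>S\<close>. It is free on \<open>S\<close> if two such words with the same
  composition are equal, that is, have the same length and the same entries.\<close>

definition comp_semigroup_free_on :: "'a::comm_semiring_1 poly set \<Rightarrow> bool" where
  "comp_semigroup_free_on S \<longleftrightarrow>
    (\<forall>\<theta> \<tau>. \<theta> \<noteq> [] \<and> \<tau> \<noteq> [] \<and> set \<theta> \<subseteq> S \<and> set \<tau> \<subseteq> S \<and> comp_word \<theta> = comp_word \<tau> \<longrightarrow>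
      length \<theta> = length \<tau> \<and> (\<forall>i < length \<theta>. \<theta> ! i = \<tau> ! i))"

end

theory Submission
  imports Defs
begin

text \<open>
  Cancelling the outermost maps of two words with the same composition requires that
  \<open>g\<^sup>d + c = h\<^sup>e + c'\<close> forces \<open>d = e\<close> and \<open>c = c'\<close> (hence \<open>g = h\<close>, as all compositions are monic).
  If \<open>c \<noteq> c'\<close>, then \<open>g\<^sup>d - h\<^sup>e\<close> is a nonzero constant, and comparing derivatives shows that
  \<open>g\<^sup>d\<^sup>-\<^sup>1\<close> divides \<open>h'\<close> and \<open>h\<^sup>e\<^sup>-\<^sup>1\<close> divides \<open>g'\<close>, so each of \<open>g\<close>, \<open>h\<close> has smaller degree than
  the other. If \<open>c = c'\<close>, then \<open>g\<^sup>d = h\<^sup>e\<close> makes \<open>g\<close> and \<open>h\<close> powers of a common polynomial; but a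
  composition \<open>u\<^sup>a + b\<close> with \<open>b \<noteq> 0\<close> is not a proper power \<open>p\<^sup>i\<close>, since \<open>p\<^sup>i - u\<^sup>a = b\<close> is excluded
  by the first case.
\<close>

section \<open>Divisibility and powers of polynomials over a field\<close>

lemma bezout_poly:
  fixes p q :: "'a::field poly"
  shows "\<exists>k s t. k = s * p + t * q \<and> k dvd p \<and> k dvd q"
\<comment> \<open>Euclidean algorithm. The measure separates \<open>q = 0\<close> from the nonzero
  constants, which also have degree 0.\<close>
proof (induction "if q = 0 then 0 else Suc (degree q)" arbitrary: p q rule: less_induct)
  case less
  show ?case
  proof (cases "q = 0")
    case True
    then show ?thesis by (intro exI[of _ p] exI[of _ 1] exI[of _ 0]) auto
  next
    case False
    have "(if p mod q = 0 then 0 else Suc (degree (p mod q))) < (if q = 0 then 0 else Suc (degree q))"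
      using False degree_mod_less'[of q p] by auto
    from less[OF this] obtain k s t
      where k: "k = s * q + t * (p mod q)" "k dvd q" "k dvd p mod q" by blast
    have "k dvd p" using k(2,3) dvd_mod_iff by blast
    moreover have "k = t * p + (s - t * (p div q)) * q"
      unfolding k(1) minus_div_mult_eq_mod[symmetric] by (simp add: algebra_simps)
    ultimately show ?thesis using k(2) by blast
  qed
qed

text \<open>Dividing by the common divisor \<open>k\<close> leaves
  \<open>s * p' + t * q' = 1\<close>. Modulo \<open>p'\<close>, the power
  \<open>(t * q') ^ n\<close> is 0 because \<open>p'\<close> divides \<open>q' ^ n\<close>, and it
  is 1 because \<open>t * q' = 1 - s * p'\<close>. So \<open>p'\<close> is a unit.\<close>

lemma power_dvd_power_imp_dvd_poly:
  fixes p q :: "'a::field poly"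
  assumes "p ^ n dvd q ^ n" "0 < n"
  shows "p dvd q"
proof (cases "p = 0")
  case True
  then show ?thesis using assms by (simp add: power_0_left)
next
  case False
  obtain k s t where k: "k = s * p + t * q" "k dvd p" "k dvd q" using bezout_poly by blast
  obtain p' q' where p': "p = k * p'" and q': "q = k * q'" using k(2,3) by (meson dvdE)
  have k0: "k \<noteq> 0" using False p' by auto
  have "k * 1 = k * (s * p' + t * q')" using k(1) p' q' by (simp add: algebra_simps)
  then have one: "1 - s * p' = t * q'" by (simp only: mult_left_cancel[OF k0] diff_eq_eq add.commute)
  have "k ^ n * p' ^ n dvd k ^ n * q' ^ n" using assms p' q' by (simp add: power_mult_distrib)
  then have "p' ^ n dvd q' ^ n" using k0 by simp
  moreover have "p' dvd p' ^ n" using assms(2) by (simp add: dvd_power)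
  ultimately have "p' dvd (1 - s * p') ^ n" unfolding one power_mult_distrib
    by (meson dvd_mult dvd_trans)
  moreover have "p' dvd (1 - s * p') ^ n - 1"
  proof -
    have "(1 - s * p') - 1 dvd (1 - s * p') ^ n - 1 ^ n"
      unfolding power_diff_sumr2 by (rule dvd_triv_left)
    moreover have "p' dvd (1 - s * p') - 1" by simp
    ultimately show ?thesis by (simp only: power_one) (meson dvd_trans)
  qed
  ultimately have "p' dvd (1 - s * p') ^ n - ((1 - s * p') ^ n - 1)" by (rule dvd_diff)
  then have "p' dvd 1" by (simp only: diff_diff_eq2 add_diff_cancel_left')
  then have "p dvd k" using p' mult_dvd_mono[of k k p' 1] by simp
  then show ?thesis using k(3) by (rule dvd_trans)
qed

lemma monic_dvd_antisym:
  fixes p q :: "'a::field poly"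
  assumes "p dvd q" "q dvd p" "lead_coeff p = 1" "lead_coeff q = 1"
  shows "p = q"
proof -
  obtain r where r: "q = p * r" using assms(1) by (rule dvdE)
  have "p \<noteq> 0" "q \<noteq> 0" using assms(3,4) by auto
  then have "degree p = degree q" by (simp add: assms dvd_imp_degree_le le_antisym)
  moreover have "r \<noteq> 0" using r \<open>q \<noteq> 0\<close> by auto
  ultimately have "degree r = 0" using r \<open>p \<noteq> 0\<close> by (simp add: degree_mult_eq)
  then obtain c where "r = [:c:]" by (rule degree_eq_zeroE)
  moreover have "lead_coeff r = 1" using r assms(3,4) by (simp add: lead_coeff_mult)
  ultimately show ?thesis using r by simp
qed

lemma monic_power_eq_imp_eq:
  fixes p q :: "'a::field poly"
  assumes "p ^ n = q ^ n" "0 < n" "lead_coeff p = 1" "lead_coeff q = 1"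
  shows "p = q"
  using assms power_dvd_power_imp_dvd_poly[of p n q] power_dvd_power_imp_dvd_poly[of q n p]
  by (intro monic_dvd_antisym) auto

text \<open>Subtractive Euclidean algorithm on the exponents: if \<open>d < e\<close>, then
  \<open>h\<close> divides \<open>g\<close>, and the quotient \<open>r\<close> satisfies
  \<open>r ^ d = h ^ (e - d)\<close>. A common base of \<open>r\<close> and \<open>h\<close> also
  serves \<open>g = h * r\<close>.\<close>

lemma monic_power_eq_power_imp_common_base:
  fixes g h :: "'a::field poly"
  assumes "g ^ d = h ^ e" "0 < d" "0 < e" "lead_coeff g = 1" "lead_coeff h = 1"
  shows "\<exists>p i j. g = p ^ i \<and> h = p ^ j"
  using assms
proof (induction "d + e" arbitrary: d e g h rule: less_induct)
  case less
  \<comment> \<open>Generalised over all variables, so that the case \<open>e < d\<close> follows by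
    swapping the roles.\<close>
  have step: "\<exists>p i j. g = p ^ i \<and> h = p ^ j"
    if eq: "g ^ d = h ^ e" and lt: "d < e" and d: "0 < d"
      and mon: "lead_coeff g = 1" "lead_coeff h = 1"
      and IH: "\<And>d' e' (g' :: 'a poly) h'. \<lbrakk>d' + e' < d + e; g' ^ d' = h' ^ e'; 0 < d'; 0 < e';
        lead_coeff g' = 1; lead_coeff h' = 1\<rbrakk> \<Longrightarrow> \<exists>p i j. g' = p ^ i \<and> h' = p ^ j"
    for d e and g h :: "'a poly"
  proof -
    have "h ^ d dvd g ^ d" using eq lt by (simp add: le_imp_power_dvd)
    then have "h dvd g" using d by (rule power_dvd_power_imp_dvd_poly)
    then obtain r where r: "g = h * r" by (rule dvdE)
    have h0: "h \<noteq> 0" using mon by auto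
    have "h ^ d * r ^ d = h ^ d * h ^ (e - d)"
      using eq lt unfolding r by (simp add: power_mult_distrib flip: power_add)
    then have "r ^ d = h ^ (e - d)" using h0 by simp
    moreover have "lead_coeff r = 1" using mon by (simp add: r lead_coeff_mult)
    ultimately obtain p i j where "r = p ^ i" "h = p ^ j"
      using IH[of d "e - d" r h] d lt mon by auto
    then show ?thesis using r by (metis power_add)
  qed
  consider "d < e" | "e < d" | "d = e" by linarith
  then show ?case
  proof cases
    case 1
    then show ?thesis using step[of g d h e] less by blast
  next
    case 2
    then have "\<exists>p i j. h = p ^ i \<and> g = p ^ j"
      using less.prems less.hyps by (intro step[of h e g d]) (auto simp: add.commute)
    then show ?thesis by blast
  next
    case 3
    then have "g = h" using less.prems monic_power_eq_imp_eq by blast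
    then have "g = g ^ 1 \<and> h = g ^ 1" by simp
    then show ?thesis by blast
  qed
qed

section \<open>Powers that differ by a constant\<close>

lemma degree_less_if_power_diff_const:
  fixes g h :: "'a::field_char_0 poly"
  assumes eq: "g ^ d - h ^ e = [:c:]" and "c \<noteq> 0" "2 \<le> d" "0 < e" "0 < degree h"
  shows "degree g < degree h"
proof -
  have gd: "g ^ d = g ^ (d - 1) * g" and he: "h ^ e = h ^ (e - 1) * h"
    using assms by (simp_all flip: power_Suc2)
  have "pderiv (g ^ d) - pderiv (h ^ e) = 0" unfolding pderiv_diff[symmetric] eq by simp
  then have "smult (of_nat e) (h ^ (e - 1) * pderiv h) = g ^ (d - 1) * smult (of_nat d) (pderiv g)"
    by (simp add: pderiv_power)
  then have "g ^ (d - 1) dvd smult (of_nat e) (h ^ (e - 1) * pderiv h)" by (metis dvd_triv_left)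
  then have "g ^ (d - 1) dvd h ^ (e - 1) * pderiv h" using \<open>0 < e\<close> by (simp add: dvd_smult_iff)
  \<comment> \<open>Both terms are multiples of \<open>g ^ (d - 1)\<close>, and their difference is
    the unit \<open>[:c:]\<close> times \<open>pderiv h\<close>.\<close>
  then have "g ^ (d - 1) dvd g ^ (d - 1) * (g * pderiv h) - h ^ (e - 1) * pderiv h * h"
    by (rule dvd_diff[OF dvd_triv_left dvd_mult2])
  also have "\<dots> = (g ^ d - h ^ e) * pderiv h" unfolding gd he by (simp add: algebra_simps)
  finally have "g ^ (d - 1) dvd pderiv h" unfolding eq using \<open>c \<noteq> 0\<close> by (simp add: dvd_smult_iff)
  \<comment> \<open>Characteristic zero enters here: divisibility bounds degrees only if
    \<open>pderiv h\<close> is nonzero.\<close>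
  moreover have "pderiv h \<noteq> 0" using \<open>0 < degree h\<close> by (simp add: pderiv_eq_0_iff)
  moreover have "g dvd g ^ (d - 1)" using \<open>2 \<le> d\<close> by (simp add: dvd_power)
  ultimately have "degree g \<le> degree (pderiv h)" by (meson dvd_imp_degree_le dvd_trans)
  then show ?thesis using \<open>0 < degree h\<close> by (simp add: degree_pderiv)
qed

lemma power_diff_not_const:
  fixes g h :: "'a::field_char_0 poly"
  assumes "g ^ d - h ^ e = [:c:]" "2 \<le> d" "2 \<le> e" "0 < degree g" "0 < degree h"
  shows "c = 0"
proof (rule ccontr)
  assume "c \<noteq> 0"
  have "h ^ e - g ^ d = - [:c:]" using assms(1) by (metis minus_diff_eq)
  then have "h ^ e - g ^ d = [:- c:]" by simp
  then have "degree h < degree g"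
    using assms \<open>c \<noteq> 0\<close> by (intro degree_less_if_power_diff_const[of h e g d "- c"]) auto
  moreover have "degree g < degree h"
    using assms \<open>c \<noteq> 0\<close> by (intro degree_less_if_power_diff_const[of g d h e c]) auto
  ultimately show False by simp
qed

section \<open>Compositions of words in the generators\<close>

lemma comp_word_Nil [simp]: "comp_word [] = [:0, 1:]"
  by (simp add: comp_word_def)

lemma pcompose_monom_one: "pcompose (monom 1 n) p = p ^ n"
  for p :: "'a::comm_semiring_1 poly"
  by (induction n) (simp_all add: monom_Suc pcompose_pCons one_pCons)

lemma comp_word_Cons:
  "comp_word ((monom 1 d + [:c:]) # ps) = comp_word ps ^ d + [:c:]"
  by (simp add: comp_word_def pcompose_add pcompose_monom_one)

lemma lead_coeff_power_add_const:
  fixes u :: "'a::idom poly"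
  assumes "0 < degree u" "0 < a"
  shows "lead_coeff (u ^ a + [:b:]) = lead_coeff u ^ a"
    and "degree (u ^ a + [:b:]) = a * degree u"
proof -
  have u: "u \<noteq> 0" using assms by auto
  then have "degree [:b:] < degree (u ^ a)" using assms by (simp add: degree_power_eq)
  then show deg: "degree (u ^ a + [:b:]) = a * degree u"
    using u by (simp add: degree_add_eq_left degree_power_eq)
  have "coeff [:b:] (degree (u ^ a)) = 0"
    using \<open>degree [:b:] < degree (u ^ a)\<close> by (rule coeff_eq_0)
  moreover have "degree (u ^ a + [:b:]) = degree (u ^ a)"
    using \<open>degree [:b:] < degree (u ^ a)\<close> by (rule degree_add_eq_left)
  ultimately show "lead_coeff (u ^ a + [:b:]) = lead_coeff u ^ a"
    by (simp only: coeff_add add_0_right lead_coeff_power)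
qed

lemma comp_word_unicritical:
  assumes "set ps \<subseteq> (unicritical_polys :: 'k::field_char_0 poly set)"
  shows "lead_coeff (comp_word ps) = 1 \<and> 0 < degree (comp_word ps)"
  using assms
proof (induction ps)
  case (Cons p ps)
  then obtain d c where "p = monom 1 d + [:c:]" "2 \<le> d" by (auto simp: unicritical_polys_def)
  then show ?case
    using Cons lead_coeff_power_add_const[of "comp_word ps" d c] by (simp add: comp_word_Cons)
qed simp

lemma comp_word_unicritical_cases:
  assumes "set ps \<subseteq> (unicritical_polys :: 'k::field_char_0 poly set)"
  obtains "ps = []"
  | u a b where "comp_word ps = u ^ a + [:b:]" "2 \<le> a" "b \<noteq> 0" "0 < degree u"
proof (cases ps)
  case (Cons p qs)
  moreover from this obtain d c where "p = monom 1 d + [:c:]" "2 \<le> d" "c \<noteq> 0"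
    using assms by (auto simp: unicritical_polys_def)
  ultimately show ?thesis using that(2)[of "comp_word qs" d c] assms comp_word_unicritical[of qs]
    by (simp add: comp_word_Cons)
qed (use that in auto)

lemma degree_comp_word_unicritical_ge:
  assumes "set ps \<subseteq> (unicritical_polys :: 'k::field_char_0 poly set)" "ps \<noteq> []"
  shows "2 \<le> degree (comp_word ps)"
  using assms(1)
proof (cases rule: comp_word_unicritical_cases)
  case (2 u a b)
  then have "degree (comp_word ps) = a * degree u" by (simp add: lead_coeff_power_add_const)
  moreover have "2 * 1 \<le> a * degree u" using 2 by (intro mult_mono) auto
  ultimately show ?thesis by simp
qed (use assms in simp)

text \<open>The empty word must be covered, since cancelling an outermost map may leave nothing;
  there \<open>z\<close> has degree 1, which is no multiple of \<open>i\<close> when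
  \<open>2 \<le> i\<close>.\<close>

lemma comp_word_unicritical_not_power:
  assumes ps: "set ps \<subseteq> (unicritical_polys :: 'k::field_char_0 poly set)"
    and eq: "comp_word ps = p ^ i"
  shows "i = 1"
proof (rule ccontr)
  assume "i \<noteq> 1"
  have "0 < degree (p ^ i)" using comp_word_unicritical[OF ps] eq by simp
  moreover have "degree (p ^ i) \<le> degree p * i" by (rule degree_power_le)
  ultimately have "0 < degree p * i" by linarith
  then have "i \<noteq> 0" "0 < degree p" by auto
  moreover from this have "p \<noteq> 0" by auto
  ultimately have i: "2 \<le> i" and deg: "degree (p ^ i) = i * degree p"
    using \<open>i \<noteq> 1\<close> by (auto simp: degree_power_eq)
  from ps show False
  proof (cases rule: comp_word_unicritical_cases)
    case 1
    then have "i * degree p = degree [:0, 1::'k:]" using eq deg by (simp only: comp_word_Nil)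
    then show False using i by simp
  next
    case (2 u a b)
    then have "p ^ i - u ^ a = [:b:]" using eq by (simp add: algebra_simps)
    then show False using power_diff_not_const 2 i \<open>0 < degree p\<close> by blast
  qed
qed

text \<open>Admitting empty words lets the induction cancel outermost maps down to
  \<open>[]\<close>; nonempty words have degree at least 2, so none of them composes to
  \<open>z\<close>.\<close>

lemma comp_word_unicritical_inj:
  assumes "set ps \<subseteq> (unicritical_polys :: 'k::field_char_0 poly set)" "set qs \<subseteq> unicritical_polys"
    and "comp_word ps = comp_word qs"
  shows "ps = qs"
  using assms
proof (induction ps arbitrary: qs)
  case Nil
  have "degree (comp_word qs) = 1" unfolding Nil.prems(3)[symmetric] by simp
  then show ?case using Nil.prems(2) degree_comp_word_unicritical_ge[of qs] by fastforce
next
  case (Cons p ps)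
  have "qs \<noteq> []" using Cons.prems degree_comp_word_unicritical_ge[of "p # ps"] by auto
  then obtain q qs' where qs: "qs = q # qs'" by (cases qs) auto
  obtain d c where p: "p = monom 1 d + [:c:]" "2 \<le> d"
    using Cons.prems by (auto simp: unicritical_polys_def)
  obtain e c' where q: "q = monom 1 e + [:c':]" "2 \<le> e"
    using Cons.prems by (auto simp: qs unicritical_polys_def)
  define g h where "g = comp_word ps" and "h = comp_word qs'"
  have sub: "set ps \<subseteq> unicritical_polys" "set qs' \<subseteq> unicritical_polys"
    using Cons.prems qs by auto
  have g: "lead_coeff g = 1" "0 < degree g" and h: "lead_coeff h = 1" "0 < degree h"
    unfolding g_def h_def using comp_word_unicritical sub by blast+
  have eq: "g ^ d + [:c:] = h ^ e + [:c':]"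
    using Cons.prems(3) by (simp add: qs p q comp_word_Cons g_def h_def)
  then have "g ^ d = h ^ e + ([:c':] - [:c:])" by (simp only: add_diff_eq eq_diff_eq)
  then have "g ^ d - h ^ e = [:c':] - [:c:]" by (simp only: add_diff_cancel_left')
  then have "g ^ d - h ^ e = [:c' - c:]" by simp
  then have "c' - c = 0" using p q g h by (intro power_diff_not_const[of g d h e]) auto
  then have c: "c = c'" and pow: "g ^ d = h ^ e" using eq by auto
  have "\<exists>r i j. g = r ^ i \<and> h = r ^ j"
    using p q g h by (intro monic_power_eq_power_imp_common_base[OF pow]) auto
  \<comment> \<open>Neither side is a proper power, so \<open>i = j = 1\<close> and both equal
    \<open>r\<close>.\<close>
  then have gh: "g = h"
    using comp_word_unicritical_not_power sub unfolding g_def h_def by metis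
  have "d * degree g = e * degree g" using arg_cong[OF pow, of degree] g
    by (cases "g = 0") (simp_all add: degree_power_eq flip: gh)
  then have "d = e" using g by simp
  then show ?case using Cons.IH[OF sub] gh p q qs c by (simp add: g_def h_def)
qed

theorem theorem3p1:
  shows "comp_semigroup_free_on (unicritical_polys :: 'k::field_char_0 poly set)"
  unfolding comp_semigroup_free_on_def using comp_word_unicritical_inj by blast

end
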